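(* Let $r\geq 1$ and $n\geq 2r$ be integers, and let $G$ be a disjoint union of $n$ graphs, each of which is a complete graph, a cycle or a path, and at least one of which is an isolated singleton (a single vertex). Then $G$ is $r$-EKR.
   Context: Graphs are finite and simple. An independent set in a graph $G=(V,E)$ is a subset of $V$ not containing any edge of $G$. For an integer $r\geq 1$, $\mathcal{I}^{(r)}(G)=\{A\subseteq V(G) : |A|=r \text{ and } A \text{ is an independent set}\}$. For $v\in V(G)$, the star at $v$ is $\mathcal{I}_v^{(r)}(G)=\{A\in \mathcal{I}^{(r)}(G): v\in A\}$. A family of sets is intersecting if any two of its members have non-empty intersection. A graph $G$ is $r$-EKR if no intersecting family $\mathcal{A}\subseteq\mathcal{I}^{(r)}(G)$ is larger than the largest star, i.e. every intersecting $\mathcal{A}\subseteq\mathcal{I}^{(r)}(G)$ satisfies $|\mathcal{A}|\leq \max_{v\in V(G)}|\mathcal{I}_v^{(r)}(G)|$. *)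

theory Defs
  imports Main "HOL-Library.Disjoint_Sets" "HOL-Library.Ramsey"
begin

record 'a graph =
  verts :: "'a set"
  edges :: "'a set set"

definition simple_graph :: "'a graph \<Rightarrow> bool" where
  "simple_graph G \<longleftrightarrow> finite (verts G) \<and> edges G \<subseteq> nsets (verts G) 2"

text \<open>The null graph is excluded from each of the three classes below; admitting it would make
  the number of components of a disjoint union meaningless.\<close>

definition is_complete :: "'a graph \<Rightarrow> bool" where
  "is_complete G \<longleftrightarrow> finite (verts G) \<and> verts G \<noteq> {} \<and> edges G = nsets (verts G) 2"

text \<open>Cycles have length at least 3, and the one-vertex graph counts as a path.\<close>

definition is_cycle :: "'a graph \<Rightarrow> bool" where
  "is_cycle G \<longleftrightarrow>
     (\<exists>vs. 3 \<le> length vs \<and> distinct vs \<and> verts G = set vs \<and>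
        edges G = {{vs ! i, vs ! (Suc i mod length vs)} | i. i < length vs})"

definition is_path :: "'a graph \<Rightarrow> bool" where
  "is_path G \<longleftrightarrow>
     (\<exists>vs. vs \<noteq> [] \<and> distinct vs \<and> verts G = set vs \<and>
        edges G = {{vs ! i, vs ! Suc i} | i. Suc i < length vs})"

definition is_singleton_graph :: "'a graph \<Rightarrow> bool" where
  "is_singleton_graph G \<longleftrightarrow> (\<exists>v. verts G = {v} \<and> edges G = {})"

definition is_disjoint_union :: "'a graph \<Rightarrow> 'i set \<Rightarrow> ('i \<Rightarrow> 'a graph) \<Rightarrow> bool" where
  "is_disjoint_union G I H \<longleftrightarrow>
     disjoint_family_on (\<lambda>i. verts (H i)) I \<and>
     verts G = (\<Union>i\<in>I. verts (H i)) \<and> edges G = (\<Union>i\<in>I. edges (H i))"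

definition independent_set :: "'a graph \<Rightarrow> 'a set \<Rightarrow> bool" where
  "independent_set G A \<longleftrightarrow> A \<subseteq> verts G \<and> (\<forall>e\<in>edges G. \<not> e \<subseteq> A)"

definition indep_family :: "nat \<Rightarrow> 'a graph \<Rightarrow> 'a set set" where
  "indep_family r G = {A. A \<subseteq> verts G \<and> card A = r \<and> independent_set G A}"

definition star :: "nat \<Rightarrow> 'a graph \<Rightarrow> 'a \<Rightarrow> 'a set set" where
  "star r G v = {A \<in> indep_family r G. v \<in> A}"

definition intersecting :: "'a set set \<Rightarrow> bool" where
  "intersecting F \<longleftrightarrow> (\<forall>A\<in>F. \<forall>B\<in>F. A \<inter> B \<noteq> {})"

text \<open>Only meaningful for finite graphs with at least one vertex, since \<^const>\<open>Max\<close> and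
  \<^const>\<open>card\<close> are.\<close>

definition EKR :: "nat \<Rightarrow> 'a graph \<Rightarrow> bool" where
  "EKR r G \<longleftrightarrow>
     (\<forall>F. F \<subseteq> indep_family r G \<longrightarrow> intersecting F \<longrightarrow>
        card F \<le> Max ((\<lambda>v. card (star r G v)) ` verts G))"

lemma is_complete_imp_simple_graph: "is_complete G \<Longrightarrow> simple_graph G"
  by (auto simp: is_complete_def simple_graph_def)

lemma is_path_imp_simple_graph: "is_path G \<Longrightarrow> simple_graph G"
  by (auto simp: is_path_def simple_graph_def nsets_def nth_eq_iff_index_eq)

lemma is_cycle_imp_simple_graph:
  assumes "is_cycle G"
  shows "simple_graph G"
proof -
  obtain vs where vs: "3 \<le> length vs" "distinct vs" "verts G = set vs"
    and E: "edges G = {{vs ! i, vs ! (Suc i mod length vs)} | i. i < length vs}"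
    using assms by (auto simp: is_cycle_def)
  have "{vs ! i, vs ! (Suc i mod length vs)} \<in> nsets (set vs) 2" if i: "i < length vs" for i
  proof -
    have j: "Suc i mod length vs < length vs"
      using vs(1) by (intro mod_less_divisor) linarith
    have "i \<noteq> Suc i mod length vs"
      using i vs(1) by (cases "Suc i = length vs") auto
    then have "vs ! i \<noteq> vs ! (Suc i mod length vs)"
      using i j vs(2) by (simp add: nth_eq_iff_index_eq)
    then show ?thesis
      using i j by (auto simp: nsets_def)
  qed
  then show ?thesis
    using vs E by (auto simp: simple_graph_def)
qed

end

theory Submission
  imports Defs
begin

text \<open>Contract an edge \<open>vw\<close> inside one component. Merging \<open>v\<close> into \<open>w\<close> identifies two members
  \<open>S + v\<close> and \<open>S + w\<close> of an intersecting family \<open>F\<close> and fails to give an independent set when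
  only one of \<open>S + v\<close>, \<open>S + w\<close> is independent; the sets \<open>S\<close> lost in either way form an
  intersecting family of \<open>(r - 1)\<close>-sets in a smaller graph. So
  \<open>card F\<close> is the sum of the sizes of two intersecting families, and the star at the isolated
  vertex \<open>x\<close> splits in the same way. Contraction turns \<open>C\<^sub>m\<close> into \<open>C\<^bsub>m-1\<^esub>\<close> with residual
  graph \<open>C\<^bsub>m-2\<^esub>\<close>, and similarly for paths; \<open>K\<^sub>m\<close> becomes \<open>K\<^bsub>m-1\<^esub>\<close> with an empty residual
  component. At most one component is lost while \<open>r\<close> drops by one, so \<open>n \<ge> 2r\<close> is preserved,
  and the induction ends at the classical Erdos-Ko-Rado theorem for \<open>n\<close> isolated vertices.\<close>

section \<open>Star bounds for layers of a set system\<close>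

definition layer :: "nat \<Rightarrow> 'a set set \<Rightarrow> 'a set set" where
  "layer r J = {A \<in> J. card A = r}"

text \<open>Phrased for set systems instead of graphs, since contraction also produces systems such
  as \<open>{{}}\<close>. The centre \<open>x\<close> is fixed, not chosen by a maximum, so that the
  bounds for the two parts of a contraction add up; \<open>n\<close> plays the role of the number of
  components.\<close>

definition star_bounded :: "'a \<Rightarrow> nat \<Rightarrow> 'a set set \<Rightarrow> bool" where
  "star_bounded x n J \<longleftrightarrow>
     (\<forall>r F. 2 * r \<le> n \<longrightarrow> F \<subseteq> layer r J \<longrightarrow> intersecting F \<longrightarrow>
        card F \<le> card {A \<in> layer r J. x \<in> A})"

lemma star_boundedD:
  assumes "star_bounded x n J" "2 * r \<le> n" "F \<subseteq> layer r J" "intersecting F"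
  shows "card F \<le> card {A \<in> layer r J. x \<in> A}"
  using assms by (auto simp: star_bounded_def)

lemma intersectingD: "intersecting F \<Longrightarrow> A \<in> F \<Longrightarrow> B \<in> F \<Longrightarrow> A \<inter> B \<noteq> {}"
  by (auto simp: intersecting_def)

lemma inj_on_insert:
  assumes "\<And>S. S \<in> P \<Longrightarrow> v \<notin> S"
  shows "inj_on (insert v) P"
  by (intro inj_onI) (metis Diff_insert_absorb assms)

lemmas card_insert_image = card_image[OF inj_on_insert]

lemma card_swap:
  assumes "finite A" "v \<in> A" "j \<notin> A"
  shows "card (insert j (A - {v})) = card A"
proof -
  have "Suc (card (A - {v})) = card A" using assms by (metis card_Suc_Diff1)
  then show ?thesis using assms by simp
qed

text \<open>\<open>intersecting\<close> also compares a set with itself, which excludes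
  \<open>{}\<close>; finiteness excludes infinite sets, whose \<open>card\<close> is 0 by
  default.\<close>

lemma intersecting_layer_0:
  assumes "F \<subseteq> layer 0 J" "intersecting F" "\<And>A. A \<in> J \<Longrightarrow> finite A"
  shows "F = {}"
proof -
  have "F \<subseteq> {{}}" using assms(1,3) by (auto simp: layer_def)
  then show ?thesis using assms(2) by (auto simp: intersecting_def)
qed

subsection \<open>The Erdos-Ko-Rado theorem\<close>

text \<open>The compression operator of extremal set theory, directed away from
  \<open>v\<close>.\<close>

definition shift :: "'a \<Rightarrow> 'a \<Rightarrow> 'a set set \<Rightarrow> 'a set \<Rightarrow> 'a set" where
  "shift v j F A =
     (if v \<in> A \<and> j \<notin> A \<and> insert j (A - {v}) \<notin> F then insert j (A - {v}) else A)"

text \<open>A moved set lands outside \<open>F\<close>, so it cannot coincide with an unmoved one,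
  and two moved sets are recovered by undoing the swap.\<close>

lemma inj_on_shift:
  assumes "v \<noteq> j"
  shows "inj_on (shift v j F) F"
proof (rule inj_onI)
  fix A B assume AB: "A \<in> F" "B \<in> F" and eq: "shift v j F A = shift v j F B"
  have *: "A = B" if "insert j (A - {v}) = insert j (B - {v})"
      "v \<in> A" "v \<in> B" "j \<notin> A" "j \<notin> B" for A B :: "'a set"
    using that by (metis Diff_iff Diff_insert_absorb insert_Diff)
  show "A = B"
    using eq AB *[of A B] by (auto simp: shift_def split: if_splits)
qed

text \<open>Two moved sets share \<open>j\<close>. Let \<open>A\<close> be moved and
  \<open>B\<close> not. If \<open>B\<close> contains \<open>v\<close> but not \<open>j\<close>, its
  swapped copy is already in \<open>F\<close> and meets \<open>A\<close> in a point other than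
  \<open>v\<close> and \<open>j\<close>. Otherwise either \<open>j\<close> lies in \<open>B\<close>,
  or \<open>v\<close> does not and a common point of \<open>A\<close> and \<open>B\<close> survives
  the swap.\<close>

lemma intersecting_shift:
  assumes "v \<noteq> j" and F: "intersecting F"
  shows "intersecting (shift v j F ` F)"
proof -
  have moved: "insert j (A - {v}) \<inter> B \<noteq> {}"
    if "A \<in> F" "B \<in> F" "v \<in> A" "j \<notin> A" "insert j (A - {v}) \<notin> F"
      and B: "\<not> (v \<in> B \<and> j \<notin> B \<and> insert j (B - {v}) \<notin> F)" for A B
  proof (cases "v \<in> B \<and> j \<notin> B")
    case True
    then have "insert j (B - {v}) \<in> F" using B by blast
    then have "A \<inter> insert j (B - {v}) \<noteq> {}" using F that by (blast dest: intersectingD)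
    then show ?thesis using that by blast
  next
    case False
    have "A \<inter> B \<noteq> {}" using F that by (blast dest: intersectingD)
    then show ?thesis using that False by blast
  qed
  have "shift v j F A \<inter> shift v j F B \<noteq> {}" if "A \<in> F" "B \<in> F" for A B
  proof (cases "v \<in> A \<and> j \<notin> A \<and> insert j (A - {v}) \<notin> F")
    case A: True
    show ?thesis
    proof (cases "v \<in> B \<and> j \<notin> B \<and> insert j (B - {v}) \<notin> F")
      case True
      with A show ?thesis by (auto simp: shift_def)
    next
      case False
      with A moved[of A B] that show ?thesis by (auto simp: shift_def)
    qed
  next
    case A: False
    show ?thesis
    proof (cases "v \<in> B \<and> j \<notin> B \<and> insert j (B - {v}) \<notin> F")
      case True
      have "insert j (B - {v}) \<inter> A \<noteq> {}" using moved[of B A] A True that by blast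
      with A True show ?thesis by (auto simp: shift_def)
    next
      case False
      with A show ?thesis using F that by (auto simp: shift_def dest: intersectingD)
    qed
  qed
  then show ?thesis by (auto simp: intersecting_def)
qed

text \<open>Among the intersecting families of the same size take one with the fewest members
  containing \<open>v\<close>. If some swap were missing from it, the corresponding shift would
  lower this number further.\<close>

lemma shift_stable_family_exists:
  fixes F :: "'a set set"
  assumes "finite V" "v \<in> V" "F \<subseteq> layer r (Pow V)" "intersecting F"
  obtains F' where "F' \<subseteq> layer r (Pow V)" "intersecting F'" "card F' = card F"
    "\<And>A j. A \<in> F' \<Longrightarrow> v \<in> A \<Longrightarrow> j \<in> V \<Longrightarrow> j \<notin> A \<Longrightarrow> insert j (A - {v}) \<in> F'"
proof -
  let ?Q = "\<lambda>F'. F' \<subseteq> layer r (Pow V) \<and> intersecting F' \<and> card F' = card F"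
  let ?m = "\<lambda>F'::'a set set. card {A \<in> F'. v \<in> A}"
  obtain F' where Q: "?Q F'" and min: "\<And>F''. ?Q F'' \<Longrightarrow> ?m F' \<le> ?m F''"
    using ex_has_least_nat[of ?Q F ?m] assms by blast
  have "insert j (A - {v}) \<in> F'" if A: "A \<in> F'" "v \<in> A" and j: "j \<in> V" "j \<notin> A" for A j
  proof (rule ccontr)
    assume n: "insert j (A - {v}) \<notin> F'"
    have vj: "v \<noteq> j" using A j by blast
    have finF: "finite F'"
      using Q assms(1) by (auto simp: layer_def intro: finite_subset[of _ "Pow V"])
    have "shift v j F' B \<in> layer r (Pow V)" if "B \<in> F'" for B
    proof -
      have B: "B \<subseteq> V" "card B = r" using that Q by (auto simp: layer_def)
      have "finite B" using B assms(1) finite_subset by blast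
      then have "v \<in> B \<Longrightarrow> j \<notin> B \<Longrightarrow> card (insert j (B - {v})) = r"
        using B card_swap by metis
      then show ?thesis using B j by (auto simp: layer_def shift_def)
    qed
    then have "?Q (shift v j F' ` F')"
      using Q intersecting_shift[OF vj] card_image[OF inj_on_shift[OF vj]] by force
    then have le: "?m F' \<le> ?m (shift v j F' ` F')" by (rule min)
    have "{B \<in> shift v j F' ` F'. v \<in> B} \<subseteq> {B \<in> F'. v \<in> B} - {A}"
      using A j n vj by (auto simp: shift_def split: if_splits)
    then have "?m (shift v j F' ` F') \<le> card ({B \<in> F'. v \<in> B} - {A})"
      using finF by (intro card_mono) auto
    also have "\<dots> < ?m F'" using A finF by (intro psubset_card_mono) auto
    finally show False using le by simp
  qed
  then show ?thesis using that Q by blast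
qed

lemma card_split_at:
  assumes "finite F"
  shows "card F = card {A \<in> F. v \<notin> A} + card {S. v \<notin> S \<and> insert v S \<in> F}"
proof -
  have i: "insert v ` {S. v \<notin> S \<and> insert v S \<in> F} = {A \<in> F. v \<in> A}"
    by (auto simp: image_def insert_absorb) (metis insert_absorb mk_disjoint_insert)
  have "card {S. v \<notin> S \<and> insert v S \<in> F} = card {A \<in> F. v \<in> A}"
    unfolding i[symmetric] by (rule card_insert_image[symmetric]) auto
  moreover have "card F = card {A \<in> F. v \<notin> A} + card {A \<in> F. v \<in> A}"
    using assms by (subst card_Un_disjoint[symmetric]) (auto intro: arg_cong[of _ _ card])
  ultimately show ?thesis by simp
qed

text \<open>Induction on the ground set: delete a point \<open>v\<close> other than \<open>x\<close>
  and bound separately the members avoiding \<open>v\<close> and the link of \<open>v\<close>.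
  Compression away from \<open>v\<close> makes the link intersecting when
  \<open>2 * r < card V\<close>; the boundary case pairs each set with its complement.\<close>

lemma erdos_ko_rado:
  assumes "finite V" "x \<in> V" "2 * r \<le> card V"
    and "F \<subseteq> layer r (Pow V)" "intersecting F"
  shows "card F \<le> card {A \<in> layer r (Pow V). x \<in> A}"
  using assms
proof (induction "card V" arbitrary: V r F)
  case 0
  then show ?case by auto
next
  case (Suc n)
  have finP: "finite (layer r (Pow W))" if "finite W" for W :: "'a set"
    using that by (auto simp: layer_def)
  have sub: "finite A" "card A = r" "A \<subseteq> V" if "A \<in> layer r (Pow V)" for A
    using that Suc.prems(1) by (auto simp: layer_def finite_subset)
  show ?case
  proof (cases "2 * r = card V")
    case True
    \<comment> \<open>An intersecting family contains at most one of \<open>A\<close> and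
      \<open>V - A\<close>, so choosing from each pair the set that contains \<open>x\<close> is
      injective.\<close>
    let ?S = "{A \<in> layer r (Pow V). x \<in> A}" and ?g = "\<lambda>A. if x \<in> A then A else V - A"
    have "card (V - A) = r" if "A \<in> layer r (Pow V)" for A
      using sub[OF that] True by (simp add: card_Diff_subset)
    then have "?g ` F \<subseteq> ?S"
      using Suc.prems by (auto simp: layer_def)
    moreover have "inj_on ?g F"
    proof (rule inj_onI)
      fix A B assume AB: "A \<in> F" "B \<in> F" "?g A = ?g B"
      have "A \<inter> B \<noteq> {}" "A \<subseteq> V" "B \<subseteq> V"
        using AB Suc.prems by (auto simp: layer_def dest: intersectingD)
      then show "A = B" using AB(3) by (auto split: if_splits)
    qed
    moreover have "finite ?S" using finP[OF Suc.prems(1)] by simp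
    ultimately show ?thesis using card_inj_on_le[of ?g F ?S] by blast
  next
    case False
    then have lt: "2 * r < card V" using Suc.prems by simp
    show ?thesis
    proof (cases "V = {x}")
      case True
      then have "r = 0" using lt by simp
      then have "F = {}"
        using intersecting_layer_0[of F "Pow V"] Suc.prems finite_subset by blast
      then show ?thesis by simp
    next
      case False
      then obtain v where v: "v \<in> V" "v \<noteq> x" using Suc.prems by blast
      define W where "W = V - {v}"
      have W: "finite W" "x \<in> W" "card W = n"
        using v Suc by (auto simp: W_def)
      \<comment> \<open>In general the link of \<open>v\<close> in \<open>F\<close> need not be
        intersecting, as two members may meet in \<open>v\<close> only; stability under swaps
        repairs this.\<close>
      obtain F' where F': "F' \<subseteq> layer r (Pow V)" "intersecting F'" "card F' = card F"
        and stable: "\<And>A j. A \<in> F' \<Longrightarrow> v \<in> A \<Longrightarrow> j \<in> V \<Longrightarrow> j \<notin> A \<Longrightarrow> insert j (A - {v}) \<in> F'"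
        using shift_stable_family_exists[OF Suc.prems(1) v(1) Suc.prems(4,5)] by metis
      have finF: "finite F'" using F' finP[OF Suc.prems(1)] finite_subset by blast
      let ?T = "{A \<in> layer r (Pow V). x \<in> A}"
      have rest: "card {A \<in> F'. v \<notin> A} \<le> card {A \<in> layer r (Pow W). x \<in> A}"
        using W F' lt Suc.hyps by (intro Suc.hyps(1)) (auto simp: layer_def W_def intersecting_def)
      have link: "card {S. v \<notin> S \<and> insert v S \<in> F'}
          \<le> card {A \<in> layer (r - 1) (Pow W). x \<in> A}"
      proof (intro Suc.hyps(1))
        have "card S = r - 1 \<and> S \<subseteq> W" if "v \<notin> S" "insert v S \<in> F'" for S
          using that F'(1) sub[of "insert v S"] by (auto simp: W_def)
        then show "{S. v \<notin> S \<and> insert v S \<in> F'} \<subseteq> layer (r - 1) (Pow W)"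
          by (auto simp: layer_def)
        have "S \<inter> T \<noteq> {}" if "v \<notin> S" "insert v S \<in> F'" "v \<notin> T" "insert v T \<in> F'" for S T
        proof
          assume e: "S \<inter> T = {}"
          have c: "card (insert v S) = r" "card (insert v T) = r" "finite S" "finite T"
            "insert v S \<subseteq> V" "insert v T \<subseteq> V"
            using sub[OF subsetD[OF F'(1) that(2)]] sub[OF subsetD[OF F'(1) that(4)]]
            by simp_all
          \<comment> \<open>Here \<open>2 * r < card V\<close> is essential: it leaves a point
            \<open>j\<close> outside both sets. Trading \<open>v\<close> for \<open>j\<close> in the
            first set gives a member of \<open>F'\<close> that meets the second one in neither
            \<open>v\<close> nor \<open>j\<close>, hence inside both \<open>S\<close> and
            \<open>T\<close>.\<close>
          have "card (insert v S \<union> insert v T) < card V"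
            using card_Un_le[of "insert v S" "insert v T"] c(1,2) lt by linarith
          then obtain j where j: "j \<in> V" "j \<notin> insert v S \<union> insert v T"
            using c(5,6) by (metis Un_least equalityI less_irrefl subsetI)
          then have "insert j (insert v S - {v}) \<in> F'" using stable that by blast
          then have "insert j (insert v S - {v}) \<inter> insert v T \<noteq> {}"
            using F'(2) that by (blast dest: intersectingD)
          then show False using j e that by auto
        qed
        then show "intersecting {S. v \<notin> S \<and> insert v S \<in> F'}"
          by (auto simp: intersecting_def)
      qed (use W lt Suc.hyps in auto)
      have finT: "finite ?T" using finP[OF Suc.prems(1)] by simp
      have "{A \<in> ?T. v \<notin> A} = {A \<in> layer r (Pow W). x \<in> A}"
        by (auto simp: layer_def W_def)
      moreover have "{S. v \<notin> S \<and> insert v S \<in> ?T} = {A \<in> layer (r - 1) (Pow W). x \<in> A}"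
        if "r > 0"
      proof -
        have "card (insert v S) = Suc (card S)" if "v \<notin> S" "S \<subseteq> V" for S
          using that Suc.prems(1) finite_subset[of S V] by simp
        then show ?thesis using v that by (auto simp: layer_def W_def subset_Diff_insert)
      qed
      \<comment> \<open>For \<open>r = 0\<close> the truncated \<open>r - 1\<close> no longer
        describes removal of a point, so this case is settled by emptiness.\<close>
      moreover have "F' = {}" if "r = 0"
        using intersecting_layer_0[of F' "Pow V"] that F' Suc.prems(1) finite_subset by blast
      ultimately show ?thesis
        using card_split_at[OF finF, of v] card_split_at[OF finT, of v] rest link F'(3)
        by (cases "r = 0") auto
    qed
  qed
qed

subsection \<open>Contracting an edge\<close>

text \<open>\<open>J\<close> is the ambient system and \<open>F\<close> the family being contracted.
  For \<open>F = J\<close> the system of independent sets of a graph, this is the same system for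
  the graph in which \<open>v\<close> and \<open>w\<close> are identified, under the name
  \<open>w\<close>.\<close>

definition merged :: "'a \<Rightarrow> 'a \<Rightarrow> 'a set set \<Rightarrow> 'a set set \<Rightarrow> 'a set set" where
  "merged v w J F = {A. v \<notin> A \<and> (if w \<in> A
      then A \<in> J \<and> insert v (A - {w}) \<in> J \<and> (A \<in> F \<or> insert v (A - {w}) \<in> F) else A \<in> F)}"

text \<open>For \<open>F = J\<close> the three alternatives collapse to: at least one of
  \<open>insert v S\<close> and \<open>insert w S\<close> lies in \<open>J\<close>.\<close>

definition residue :: "'a \<Rightarrow> 'a \<Rightarrow> 'a set set \<Rightarrow> 'a set set \<Rightarrow> 'a set set" where
  "residue v w J F = {S. v \<notin> S \<and> w \<notin> S \<and> (insert v S \<in> F \<and> insert w S \<in> F \<or>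
      insert v S \<in> F \<and> insert w S \<notin> J \<or> insert w S \<in> F \<and> insert v S \<notin> J)}"

text \<open>\<open>P\<close> and \<open>Q\<close> are the traces of the members through
  \<open>v\<close> and through \<open>w\<close>, and \<open>R\<close> collects the sets that extend
  both ways in \<open>J\<close>. Merging counts each trace in
  \<open>(P \<union> Q) \<inter> R\<close> once. The residue counts the doubled traces
  \<open>P \<inter> Q\<close>, which lie in \<open>R\<close> as \<open>F \<subseteq> J\<close>, and
  the traces outside \<open>R\<close>. Inclusion-exclusion for \<open>P\<close> and \<open>Q\<close>
  gives the sum.\<close>

lemma card_merged_residue:
  assumes fin: "finite F" and "F \<subseteq> J" "v \<noteq> w" and vw: "\<And>A. A \<in> J \<Longrightarrow> \<not> (v \<in> A \<and> w \<in> A)"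
  shows "card F = card (merged v w J F) + card (residue v w J F)"
proof -
  define Z where "Z = {A \<in> F. v \<notin> A \<and> w \<notin> A}"
  define P where "P = {S. v \<notin> S \<and> w \<notin> S \<and> insert v S \<in> F}"
  define Q where "Q = {S. v \<notin> S \<and> w \<notin> S \<and> insert w S \<in> F}"
  define R where "R = {S. insert v S \<in> J \<and> insert w S \<in> J}"
  have v: "insert v ` P = {A \<in> F. v \<in> A}" and w: "insert w ` Q = {A \<in> F. w \<in> A}"
  proof -
    have "A \<in> insert v ` P" if "A \<in> F" "v \<in> A" for A
      using that vw[of A] assms(2,3)
      by (intro image_eqI[of _ _ "A - {v}"]) (auto simp: P_def insert_absorb)
    then show "insert v ` P = {A \<in> F. v \<in> A}" by (auto simp: P_def)
    have "A \<in> insert w ` Q" if "A \<in> F" "w \<in> A" for A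
      using that vw[of A] assms(2,3)
      by (intro image_eqI[of _ _ "A - {w}"]) (auto simp: Q_def insert_absorb)
    then show "insert w ` Q = {A \<in> F. w \<in> A}" by (auto simp: Q_def)
  qed
  have finP: "finite P"
    using v fin by (intro finite_imageD[OF _ inj_on_insert[of P v]]) (auto simp: P_def)
  have finQ: "finite Q"
    using w fin by (intro finite_imageD[OF _ inj_on_insert[of Q w]]) (auto simp: Q_def)
  have cP: "card (insert v ` P) = card P" and cQ: "card (insert w ` Q) = card Q"
    by (rule card_insert_image; auto simp: P_def Q_def)+
  have finZ: "finite Z" using fin by (simp add: Z_def)
  have "F = Z \<union> (insert v ` P \<union> insert w ` Q)"
    unfolding v w by (auto simp: Z_def)
  moreover have "insert v ` P \<inter> insert w ` Q = {}" "Z \<inter> (insert v ` P \<union> insert w ` Q) = {}"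
    unfolding v w using vw assms(2) by (auto simp: Z_def)
  ultimately have F: "card F = card Z + (card P + card Q)"
    using finP finQ finZ cP cQ by (simp add: card_Un_disjoint)
  have "merged v w J F = Z \<union> insert w ` ((P \<union> Q) \<inter> R)"
  proof (intro equalityI subsetI)
    fix A assume A: "A \<in> merged v w J F"
    show "A \<in> Z \<union> insert w ` ((P \<union> Q) \<inter> R)"
    proof (cases "w \<in> A")
      case True
      then have "A = insert w (A - {w})" "A - {w} \<in> (P \<union> Q) \<inter> R"
        using A by (auto simp: merged_def P_def Q_def R_def insert_absorb)
      then show ?thesis by blast
    qed (use A in \<open>auto simp: merged_def Z_def\<close>)
  next
    fix A assume "A \<in> Z \<union> insert w ` ((P \<union> Q) \<inter> R)"
    then show "A \<in> merged v w J F"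
      using assms(3) by (auto simp: merged_def Z_def P_def Q_def R_def)
  qed
  moreover have "Z \<inter> insert w ` ((P \<union> Q) \<inter> R) = {}" by (auto simp: Z_def)
  moreover have "card (insert w ` ((P \<union> Q) \<inter> R)) = card ((P \<union> Q) \<inter> R)"
    by (rule card_insert_image) (auto simp: P_def Q_def)
  ultimately have 1: "card (merged v w J F) = card Z + card ((P \<union> Q) \<inter> R)"
    using finP finQ finZ by (simp add: card_Un_disjoint)
  have "residue v w J F = P \<inter> Q \<union> (P \<union> Q - R)"
    using assms(2) by (auto simp: residue_def P_def Q_def R_def)
  moreover have "P \<inter> Q \<inter> (P \<union> Q - R) = {}"
    using assms(2) by (auto simp: P_def Q_def R_def)
  ultimately have 2: "card (residue v w J F) = card (P \<inter> Q) + card (P \<union> Q - R)"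
    using finP finQ by (simp add: card_Un_disjoint)
  have "card (P \<union> Q) = card ((P \<union> Q) \<inter> R) + card (P \<union> Q - R)"
    using finP finQ by (subst card_Un_disjoint[symmetric]) (auto intro: arg_cong[of _ _ card])
  then show ?thesis using F 1 2 card_Un_Int[OF finP finQ] by simp
qed

text \<open>The last two conditions say that the only obstruction to trading \<open>v\<close> for \<open>w\<close> is a single
  vertex, as for an edge of a path or a cycle; they make the residue of an intersecting family
  intersecting.\<close>

definition contractible :: "'a \<Rightarrow> 'a \<Rightarrow> 'a set set \<Rightarrow> bool" where
  "contractible v w J \<longleftrightarrow> v \<noteq> w \<and> (\<forall>A\<in>J. \<not> (v \<in> A \<and> w \<in> A)) \<and>
     (\<exists>u. \<forall>S. v \<notin> S \<longrightarrow> w \<notin> S \<longrightarrow> insert v S \<in> J \<longrightarrow> insert w S \<notin> J \<longrightarrow> u \<in> S) \<and>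
     (\<exists>t. \<forall>S. v \<notin> S \<longrightarrow> w \<notin> S \<longrightarrow> insert w S \<in> J \<longrightarrow> insert v S \<notin> J \<longrightarrow> t \<in> S)"

text \<open>Two members containing \<open>w\<close> meet there. If only \<open>A\<close> contains
  \<open>w\<close>, then \<open>A\<close> or its copy with \<open>v\<close> in place of
  \<open>w\<close> is in \<open>F\<close> and meets \<open>B\<close> in a point other than
  \<open>v\<close> and \<open>w\<close>, because \<open>B\<close> contains neither.\<close>

lemma intersecting_merged:
  assumes "intersecting F"
  shows "intersecting (merged v w J F)"
  unfolding intersecting_def
proof (intro ballI)
  fix A B assume "A \<in> merged v w J F" "B \<in> merged v w J F"
  moreover have "A' \<inter> B' \<noteq> {}" if "A' \<in> F" "B' \<in> F" for A' B'
    using that assms by (blast dest: intersectingD)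
  ultimately show "A \<inter> B \<noteq> {}"
    unfolding merged_def by (cases "w \<in> A"; cases "w \<in> B"; simp; blast)
qed

text \<open>If \<open>S\<close> extends by one of the two vertices and \<open>T\<close> by the
  other, the extensions meet outside \<open>v\<close> and \<open>w\<close>, hence in
  \<open>S \<inter> T\<close>. Otherwise both extend within \<open>F\<close> only by the same
  vertex, and the extension by the other one leaves \<open>J\<close>; then both contain the same
  obstructing vertex.\<close>

lemma intersecting_residue:
  assumes "contractible v w J" and FJ: "F \<subseteq> J" and F: "intersecting F"
  shows "intersecting (residue v w J F)"
proof -
  obtain u where u: "\<And>S. v \<notin> S \<Longrightarrow> w \<notin> S \<Longrightarrow> insert v S \<in> J \<Longrightarrow> insert w S \<notin> J \<Longrightarrow> u \<in> S"
    using assms(1) by (auto simp: contractible_def)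
  obtain t where t: "\<And>S. v \<notin> S \<Longrightarrow> w \<notin> S \<Longrightarrow> insert w S \<in> J \<Longrightarrow> insert v S \<notin> J \<Longrightarrow> t \<in> S"
    using assms(1) by (auto simp: contractible_def)
  have vw: "v \<noteq> w" using assms(1) by (simp add: contractible_def)
  have *: "S \<inter> T \<noteq> {}" if "insert v S \<in> F" "insert w T \<in> F" "w \<notin> S" "v \<notin> T" for S T
    using intersectingD[OF F that(1,2)] that vw by auto
  have "S \<inter> T \<noteq> {}" if S: "S \<in> residue v w J F" and T: "T \<in> residue v w J F" for S T
  proof (cases "insert v S \<in> F \<and> insert w T \<in> F \<or> insert v T \<in> F \<and> insert w S \<in> F")
    case True
    then show ?thesis using *[of S T] *[of T S] S T by (auto simp: residue_def)
  next
    case False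
    then consider "insert v S \<in> F" "insert w S \<notin> J" "insert v T \<in> F" "insert w T \<notin> J"
      | "insert w S \<in> F" "insert v S \<notin> J" "insert w T \<in> F" "insert v T \<notin> J"
      using S T by (auto simp: residue_def)
    then show ?thesis
    proof cases
      case 1
      then have "u \<in> S" "u \<in> T" using u S T FJ by (auto simp: residue_def)
      then show ?thesis by blast
    next
      case 2
      then have "t \<in> S" "t \<in> T" using t S T FJ by (auto simp: residue_def)
      then show ?thesis by blast
    qed
  qed
  then show ?thesis by (auto simp: intersecting_def)
qed

text \<open>Since \<open>x\<close> is neither \<open>v\<close> nor \<open>w\<close>, contraction
  cuts the star at \<open>x\<close> exactly into the stars of the two parts, so the two bounds add
  up to the star of \<open>J\<close>. The residue lives one layer lower, which is why
  \<open>n - 2\<close> suffices there.\<close>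

lemma star_bound_contract:
  assumes "contractible v w J" and fin: "finite J" "\<And>A. A \<in> J \<Longrightarrow> finite A"
    and "x \<noteq> v" "x \<noteq> w"
    and 1: "star_bounded x n (merged v w J J)"
    and 2: "star_bounded x (n - 2) (residue v w J J)"
  shows "star_bounded x n J"
  unfolding star_bounded_def
proof (intro allI impI)
  fix r F assume r: "2 * r \<le> n" and F: "F \<subseteq> layer r J" "intersecting F"
  show "card F \<le> card {A \<in> layer r J. x \<in> A}" (is "_ \<le> card ?T")
  proof (cases "r = 0")
    case True
    then have "F = {}" using intersecting_layer_0[of F J] F fin(2) by blast
    then show ?thesis by simp
  next
    case False
    have vw: "v \<noteq> w" "\<And>A. A \<in> J \<Longrightarrow> \<not> (v \<in> A \<and> w \<in> A)"
      using assms(1) by (auto simp: contractible_def)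
    have FJ: "F \<subseteq> J" "?T \<subseteq> J" using F by (auto simp: layer_def)
    have swap: "card (insert v (A - {w})) = card A" if "A \<in> J" "w \<in> A" "v \<notin> A" for A
      using that fin(2)[of A] card_swap by metis
    have finS: "finite S" if "insert v S \<in> J \<or> insert w S \<in> J" for S
      using that fin(2) by (metis finite_insert)
    have mF: "merged v w J F \<subseteq> layer r (merged v w J J)"
      using F(1) swap by (auto simp: merged_def layer_def split: if_splits)
    have rF: "residue v w J F \<subseteq> layer (r - 1) (residue v w J J)"
    proof
      fix S assume S: "S \<in> residue v w J F"
      then have "S \<in> residue v w J J" using FJ by (auto simp: residue_def)
      moreover from this have "finite S" using finS by (auto simp: residue_def)
      then have "card S = r - 1" using S F(1) by (auto simp: residue_def layer_def)
      ultimately show "S \<in> layer (r - 1) (residue v w J J)" by (simp add: layer_def)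
    qed
    have mT: "merged v w J ?T = {A \<in> layer r (merged v w J J). x \<in> A}"
      using swap assms(4,5) by (auto simp: merged_def layer_def split: if_splits)
    have rT: "residue v w J ?T = {A \<in> layer (r - 1) (residue v w J J). x \<in> A}"
      using finS assms(4,5) False by (auto simp: residue_def layer_def)
    have "card F = card (merged v w J F) + card (residue v w J F)"
      using card_merged_residue[OF _ FJ(1) vw] fin FJ finite_subset by blast
    also have "\<dots> \<le> card (merged v w J ?T) + card (residue v w J ?T)"
      unfolding mT rT
      using r F(2) assms(1) FJ(1) mF rF
      by (intro add_mono star_boundedD[OF 1] star_boundedD[OF 2] intersecting_merged
          intersecting_residue) auto
    also have "\<dots> = card ?T"
      using card_merged_residue[OF _ FJ(2) vw] fin FJ finite_subset by metis
    finally show ?thesis .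
  qed
qed


subsection \<open>Disjoint unions\<close>

text \<open>For disjoint \<open>U\<close> and \<open>V\<close> this is the join of simplicial
  complexes, which describes the independent sets of a disjoint union.\<close>

definition join :: "'a set \<Rightarrow> 'a set set \<Rightarrow> 'a set \<Rightarrow> 'a set set \<Rightarrow> 'a set set" where
  "join U L V K = {A. A \<subseteq> U \<union> V \<and> A \<inter> U \<in> L \<and> A \<inter> V \<in> K}"

text \<open>A recipe for contracting one component to a single vertex. The residue
  \<open>{{}}\<close> stands for a component that has vanished; the conditions on
  \<open>\<Union>K\<close> place \<open>v\<close> and \<open>w\<close> inside the component.\<close>

inductive reducible :: "'a set set \<Rightarrow> bool" where
  singleton: "reducible {{}, {y}}"
| contract: "contractible v w K \<Longrightarrow> v \<in> \<Union>K \<Longrightarrow> w \<in> \<Union>K \<Longrightarrow> reducible (merged v w K K) \<Longrightarrow>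
    residue v w K K = {{}} \<or> reducible (residue v w K K) \<Longrightarrow> reducible K"

lemma insert_in_join:
  assumes "U \<inter> V = {}" "v \<in> V"
  shows "insert v S \<in> join U L V K \<longleftrightarrow> S \<subseteq> U \<union> V \<and> S \<inter> U \<in> L \<and> insert v (S \<inter> V) \<in> K"
proof -
  have "v \<notin> U" using assms by blast
  then show ?thesis using assms(2) by (auto simp: join_def)
qed

text \<open>Trading \<open>v\<close> for \<open>w\<close> does not touch the part in
  \<open>U\<close>, so every failure in the join is a failure in \<open>K\<close> for
  \<open>S \<inter> V\<close>, with the same obstructing vertices.\<close>

lemma contractible_join:
  assumes "contractible v w K" "U \<inter> V = {}" "v \<in> V" "w \<in> V"
  shows "contractible v w (join U L V K)"
proof -
  obtain u where u: "\<And>S. v \<notin> S \<Longrightarrow> w \<notin> S \<Longrightarrow> insert v S \<in> K \<Longrightarrow> insert w S \<notin> K \<Longrightarrow> u \<in> S"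
    using assms(1) by (auto simp: contractible_def)
  obtain t where t: "\<And>S. v \<notin> S \<Longrightarrow> w \<notin> S \<Longrightarrow> insert w S \<in> K \<Longrightarrow> insert v S \<notin> K \<Longrightarrow> t \<in> S"
    using assms(1) by (auto simp: contractible_def)
  show ?thesis
    unfolding contractible_def
  proof (intro conjI exI allI impI ballI)
    show "v \<noteq> w" using assms(1) by (simp add: contractible_def)
    show "\<not> (v \<in> A \<and> w \<in> A)" if "A \<in> join U L V K" for A
    proof -
      have "A \<inter> V \<in> K" using that by (simp add: join_def)
      moreover have "\<forall>B\<in>K. \<not> (v \<in> B \<and> w \<in> B)"
        using assms(1) unfolding contractible_def by (elim conjE)
      ultimately have "\<not> (v \<in> A \<inter> V \<and> w \<in> A \<inter> V)" by (rule bspec[rotated])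
      then show ?thesis using assms(3,4) by simp
    qed
    show "u \<in> S" if "v \<notin> S" "w \<notin> S" "insert v S \<in> join U L V K" "insert w S \<notin> join U L V K" for S
      using that u[of "S \<inter> V"] assms(2-4) by (simp add: insert_in_join)
    show "t \<in> S" if "v \<notin> S" "w \<notin> S" "insert w S \<in> join U L V K" "insert v S \<notin> join U L V K" for S
      using that t[of "S \<inter> V"] assms(2-4) by (simp add: insert_in_join)
  qed
qed

lemma merged_join:
  assumes "U \<inter> V = {}" "v \<in> V" "w \<in> V"
  shows "merged v w (join U L V K) (join U L V K) = join U L V (merged v w K K)"
proof (rule set_eqI)
  fix A
  have "(A - {w}) \<inter> U = A \<inter> U" "(A - {w}) \<inter> V = A \<inter> V - {w}"
    using assms by auto
  then have swap: "insert v (A - {w}) \<in> join U L V K \<longleftrightarrow>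
      A - {w} \<subseteq> U \<union> V \<and> A \<inter> U \<in> L \<and> insert v (A \<inter> V - {w}) \<in> K"
    using assms by (simp add: insert_in_join)
  show "A \<in> merged v w (join U L V K) (join U L V K) \<longleftrightarrow> A \<in> join U L V (merged v w K K)"
    unfolding merged_def mem_Collect_eq swap
    unfolding join_def mem_Collect_eq
    using assms(2,3) by (cases "w \<in> A"; simp; blast)
qed

lemma residue_join:
  assumes "U \<inter> V = {}" "v \<in> V" "w \<in> V"
  shows "residue v w (join U L V K) (join U L V K) = join U L V (residue v w K K)"
  using assms by (auto simp: residue_def insert_in_join) (auto simp: join_def)

text \<open>Induction along the recipe for \<open>K\<close>, contracting inside the join.
  \<open>n\<close> counts the components behind \<open>L\<close>, so the join has one more; the
  recipe ends at a single vertex (\<open>base\<close>) or at a vanished component, which leaves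
  \<open>L\<close>.\<close>

lemma star_bounded_join:
  assumes "reducible K" "K \<subseteq> Pow V"
    and fin: "finite U" "finite V" and "U \<inter> V = {}" and "L \<subseteq> Pow U" and "x \<in> U"
    and base: "\<And>y. y \<in> V \<Longrightarrow> star_bounded x (Suc n) (join U L V {{}, {y}})"
    and L: "star_bounded x n L"
  shows "star_bounded x (Suc n) (join U L V K)"
  using assms(1,2)
proof (induction K rule: reducible.induct)
  case (singleton y)
  then show ?case using base by simp
next
  case (contract v w K)
  have vw: "v \<in> V" "w \<in> V" "x \<noteq> v" "x \<noteq> w"
    using contract.hyps(2,3) contract.prems assms(5,7) by auto
  have "A \<subseteq> U \<union> V \<and> A \<inter> U \<in> L \<and> A \<inter> V \<in> {{}} \<longleftrightarrow> A \<in> L" for A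
  proof -
    have "A \<subseteq> U \<union> V \<and> A \<inter> V \<in> {{}} \<longleftrightarrow> A \<subseteq> U" using assms(5) by blast
    then show ?thesis using assms(6) by (metis Int_absorb2 PowD subsetD)
  qed
  then have "join U L V {{}} = L" by (simp add: join_def)
  moreover have "residue v w K K \<subseteq> Pow V" "merged v w K K \<subseteq> Pow V"
    using contract.prems by (auto simp: residue_def merged_def split: if_splits)
  ultimately have 1: "star_bounded x (Suc n) (join U L V (merged v w K K))"
    and "star_bounded x n (join U L V (residue v w K K)) \<or>
      star_bounded x (Suc n) (join U L V (residue v w K K))"
    using contract.IH L by auto
  \<comment> \<open>A bound for a larger parameter covers more values of \<open>r\<close>, so both
    \<open>n\<close> and \<open>Suc n\<close> imply the case \<open>Suc n - 2\<close>.\<close>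
  then have 2: "star_bounded x (Suc n - 2) (join U L V (residue v w K K))"
    by (auto simp: star_bounded_def)
  have "join U L V K \<subseteq> Pow (U \<union> V)" by (auto simp: join_def)
  then have "finite (join U L V K)" "\<And>A. A \<in> join U L V K \<Longrightarrow> finite A"
    using fin by (meson finite_Pow_iff finite_UnI finite_subset PowD subsetD)+
  then show ?case
    using contractible_join[OF contract.hyps(1) assms(5) vw(1,2)] 1 2 vw
    by (metis star_bound_contract merged_join residue_join assms(5))
qed

text \<open>\<open>Y\<close> holds the isolated vertices and \<open>I\<close> indexes the components
  still to be contracted. A component reduced to one vertex moves from \<open>I\<close> to
  \<open>Y\<close> and keeps the total, hence the generalisation over \<open>Y\<close>; once
  \<open>I\<close> is empty, the Erdos-Ko-Rado theorem on \<open>Y\<close> applies.\<close>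

lemma star_bounded_components:
  fixes V :: "'i \<Rightarrow> 'a set" and K :: "'i \<Rightarrow> 'a set set"
  assumes "finite I" "finite Y" "x \<in> Y" "disjoint_family_on V I"
    and "\<And>i. i \<in> I \<Longrightarrow> reducible (K i) \<and> K i \<subseteq> Pow (V i) \<and> finite (V i) \<and> Y \<inter> V i = {}"
  shows "star_bounded x (card Y + card I) {A. A \<subseteq> Y \<union> \<Union>(V ` I) \<and> (\<forall>i\<in>I. A \<inter> V i \<in> K i)}"
  using assms
proof (induction I arbitrary: Y rule: finite_induct)
  case empty
  have "{A. A \<subseteq> Y} = Pow Y" by blast
  then show ?case
    using erdos_ko_rado[OF empty(1,2)] by (simp add: star_bounded_def)
next
  case (insert j I)
  define S where "S Y = {A. A \<subseteq> Y \<union> \<Union>(V ` I) \<and> (\<forall>i\<in>I. A \<inter> V i \<in> K i)}" for Y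
  define U where "U = Y \<union> \<Union>(V ` I)"
  have dj: "V i \<inter> V j = {}" if "i \<in> I" for i
    using insert.prems(3) insert.hyps(2) that by (intro disjoint_family_onD[of V "insert j I"]) auto
  have dI: "disjoint_family_on V I"
    using insert.prems(3) by (auto simp: disjoint_family_on_def)
  have K: "reducible (K j)" "K j \<subseteq> Pow (V j)" "finite (V j)"
    using insert.prems(4)[of j] by auto
  have UV: "U \<inter> V j = {}"
    using dj insert.prems(4)[of j] by (auto simp: U_def)
  have Vi: "A \<inter> U \<inter> V i = A \<inter> V i" if "i \<in> I" for A i
    using that by (auto simp: U_def)
  have "star_bounded x (Suc (card Y + card I)) (join U (S Y) (V j) (K j))"
  proof (rule star_bounded_join[OF K(1,2)])
    show "finite U" using insert.prems(1,4) insert.hyps(1) by (auto simp: U_def)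
    show "S Y \<subseteq> Pow U" by (auto simp: S_def U_def)
    \<comment> \<open>This serves the residues in which component \<open>j\<close> has
      vanished.\<close>
    show "star_bounded x (card Y + card I) (S Y)"
      unfolding S_def using insert.prems dI by (intro insert.IH) auto
    fix y assume y: "y \<in> V j"
    have yY: "y \<notin> Y" using y insert.prems(4)[of j] by auto
    have yV: "y \<notin> V i" if "i \<in> I" for i using y dj[OF that] by blast
    have "join U (S Y) (V j) {{}, {y}} = S (insert y Y)"
    proof (rule set_eqI)
      fix A
      have "A \<subseteq> U \<union> V j \<and> A \<inter> V j \<in> {{}, {y}} \<longleftrightarrow> A \<subseteq> insert y U"
        using UV y by blast
      moreover have "A \<inter> U \<in> S Y \<longleftrightarrow> (\<forall>i\<in>I. A \<inter> V i \<in> K i)"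
        by (auto simp: S_def Vi) (auto simp: U_def)
      moreover have "A \<in> S (insert y Y) \<longleftrightarrow> A \<subseteq> insert y U \<and> (\<forall>i\<in>I. A \<inter> V i \<in> K i)"
        by (simp add: S_def U_def)
      ultimately show "A \<in> join U (S Y) (V j) {{}, {y}} \<longleftrightarrow> A \<in> S (insert y Y)"
        unfolding join_def by blast
    qed
    moreover have "star_bounded x (card (insert y Y) + card I) (S (insert y Y))"
      unfolding S_def using insert.prems dI yV by (intro insert.IH) auto
    ultimately show "star_bounded x (Suc (card Y + card I)) (join U (S Y) (V j) {{}, {y}})"
      using yY insert.prems(1) by simp
  qed (use K UV insert.prems in \<open>auto simp: U_def\<close>)
  moreover have "join U (S Y) (V j) (K j) =
      {A. A \<subseteq> Y \<union> \<Union>(V ` insert j I) \<and> (\<forall>i\<in>insert j I. A \<inter> V i \<in> K i)}"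
    by (auto simp: join_def S_def Vi) (auto simp: U_def)
  ultimately show ?case using insert.hyps by simp
qed

subsection \<open>Complete graphs, paths and cycles\<close>

text \<open>These are the independent sets of a complete graph. Only \<open>S = {}\<close> avoids
  \<open>v\<close> and \<open>w\<close> and extends by either of them, and it extends by both; so no
  trade is obstructed and the residue is \<open>{{}}\<close>.\<close>

lemma reducible_singletons:
  assumes "finite V" "V \<noteq> {}"
  shows "reducible (insert {} ((\<lambda>v. {v}) ` V))"
  using assms
proof (induction V rule: finite_ne_induct)
  case (singleton y)
  then show ?case by (simp add: reducible.singleton)
next
  case (insert v V)
  then obtain w where w: "w \<in> V" "v \<noteq> w" by blast
  let ?K = "insert {} ((\<lambda>v. {v}) ` insert v V)"
  have v: "insert v S \<in> ?K \<longleftrightarrow> S \<subseteq> {v}" and w': "insert w S \<in> ?K \<longleftrightarrow> S \<subseteq> {w}" for S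
    using w by auto
  have "merged v w ?K ?K = insert {} ((\<lambda>v. {v}) ` V)"
    using w insert.hyps by (auto simp: merged_def split: if_splits)
  moreover have "residue v w ?K ?K = {{}}"
    unfolding residue_def v w' using w by blast
  moreover have "contractible v w ?K"
    unfolding contractible_def v w' using w by auto
  moreover have "v \<in> \<Union>?K" "w \<in> \<Union>?K" using w by auto
  ultimately show ?case
    using insert.IH reducible.contract[of v w ?K] by argo
qed

text \<open>The independent sets of the path along \<open>vs\<close>, stated with
  \<open>successively\<close> so that splitting off the first vertex is a rewriting step.\<close>

definition path_sets :: "'a list \<Rightarrow> 'a set set" where
  "path_sets vs = {A. A \<subseteq> set vs \<and> successively (\<lambda>x y. \<not> (x \<in> A \<and> y \<in> A)) vs}"

lemma path_sets_Cons_notin: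
  assumes "a \<notin> S"
  shows "S \<in> path_sets (a # vs) \<longleftrightarrow> S \<in> path_sets vs"
  using assms by (auto simp: path_sets_def successively_Cons)

lemma path_sets_Cons_insert:
  assumes "a \<notin> set vs" "a \<notin> S"
  shows "insert a S \<in> path_sets (a # vs) \<longleftrightarrow> S \<in> path_sets vs \<and> (vs \<noteq> [] \<longrightarrow> hd vs \<notin> S)"
proof -
  have "successively (\<lambda>x y. \<not> (x \<in> insert a S \<and> y \<in> insert a S)) vs \<longleftrightarrow>
      successively (\<lambda>x y. \<not> (x \<in> S \<and> y \<in> S)) vs"
    using assms by (intro successively_cong) auto
  moreover have "vs \<noteq> [] \<Longrightarrow> hd vs \<noteq> a" using assms by auto
  moreover have "insert a S \<subseteq> set (a # vs) \<longleftrightarrow> S \<subseteq> set vs" using assms by auto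
  ultimately show ?thesis
    by (simp only: path_sets_def mem_Collect_eq successively_Cons) auto
qed

lemma path_sets_iff:
  "A \<in> path_sets vs \<longleftrightarrow>
    A \<subseteq> set vs \<and> (\<forall>i. Suc i < length vs \<longrightarrow> \<not> {vs ! i, vs ! Suc i} \<subseteq> A)"
  by (auto simp: path_sets_def successively_conv_nth)

lemma empty_in_path_sets: "{} \<in> path_sets vs"
  by (simp add: path_sets_iff)

text \<open>Contracting the edge \<open>ab\<close> of the path \<open>a # b # q\<close> yields \<open>b # q\<close>, with residue \<open>q\<close>.\<close>

lemma reducible_path_sets:
  assumes "vs \<noteq> []" "distinct vs"
  shows "reducible (path_sets vs)"
  using assms
proof (induction "length vs" arbitrary: vs rule: less_induct)
  case less
  show ?case
  proof (cases "\<exists>a. vs = [a]")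
    case True
    then obtain a where "path_sets vs = {A. A \<subseteq> {a}}" by (auto simp: path_sets_def)
    also have "{A. A \<subseteq> {a}} = {{}, {a}}" by auto
    finally have "path_sets vs = {{}, {a}}" .
    then show ?thesis by (simp add: reducible.singleton)
  next
    case False
    then obtain a b q where vs: "vs = a # b # q"
      using less.prems(1) by (metis list.exhaust)
    then have ne: "a \<noteq> b" "a \<notin> set q" "b \<notin> set q" "distinct q" using less.prems(2) by auto
    have in_a: "insert a S \<in> path_sets vs \<longleftrightarrow> S \<in> path_sets q"
      and in_b: "insert b S \<in> path_sets vs \<longleftrightarrow> S \<in> path_sets q \<and> (q \<noteq> [] \<longrightarrow> hd q \<notin> S)"
      and in_none: "S \<in> path_sets vs \<longleftrightarrow> S \<in> path_sets q"
      if "a \<notin> S" "b \<notin> S" for S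
      using that ne by (simp_all add: vs path_sets_Cons_insert path_sets_Cons_notin)
    \<comment> \<open>Only the extension by \<open>b\<close> can fail alone, and then
      \<open>hd q\<close> lies in \<open>S\<close>; this is the witness for the first obstruction,
      and the second condition is vacuous.\<close>
    have con: "contractible a b (path_sets vs)"
      unfolding contractible_def
    proof (intro conjI exI allI impI ballI)
      show "\<not> (a \<in> A \<and> b \<in> A)" if "A \<in> path_sets vs" for A
        using that by (auto simp: vs path_sets_def)
    qed (use ne in \<open>auto simp: in_a in_b\<close>)
    have merged: "merged a b (path_sets vs) (path_sets vs) = path_sets (b # q)"
    proof (rule set_eqI)
      fix A
      consider "a \<in> A" | "a \<notin> A" "b \<notin> A" | S where "A = insert b S" "a \<notin> S" "b \<notin> S"
        by (metis insertCI mk_disjoint_insert)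
      then show "A \<in> merged a b (path_sets vs) (path_sets vs) \<longleftrightarrow> A \<in> path_sets (b # q)"
      proof cases
        case 1
        then show ?thesis using ne by (auto simp: merged_def path_sets_def)
      next
        case 2
        then show ?thesis by (simp add: merged_def in_none path_sets_Cons_notin)
      next
        case 3
        then show ?thesis using ne
          by (simp add: merged_def in_a in_b path_sets_Cons_insert) blast
      qed
    qed
    have "residue a b (path_sets vs) (path_sets vs) = path_sets q"
    proof (rule set_eqI)
      fix S
      show "S \<in> residue a b (path_sets vs) (path_sets vs) \<longleftrightarrow> S \<in> path_sets q"
      proof (cases "a \<notin> S \<and> b \<notin> S")
        case True
        then show ?thesis by (simp add: residue_def in_a in_b) blast
      next
        case False
        then show ?thesis using ne by (auto simp: residue_def path_sets_def)
      qed
    qed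
    \<comment> \<open>For a path with two vertices \<open>q\<close> is empty and the component
      vanishes in the residue.\<close>
    moreover have "path_sets [] = {{}}" by (auto simp: path_sets_def)
    moreover have "a \<in> \<Union>(path_sets vs)" "b \<in> \<Union>(path_sets vs)"
      using in_a[of "{}"] in_b[of "{}"] empty_in_path_sets[of q] by auto
    moreover have "reducible (path_sets (b # q))" "q \<noteq> [] \<Longrightarrow> reducible (path_sets q)"
      using ne by (auto simp: vs intro!: less.hyps)
    ultimately show ?thesis
      using con merged by (metis reducible.contract)
  qed
qed

definition cycle_sets :: "'a list \<Rightarrow> 'a set set" where
  "cycle_sets vs = {A \<in> path_sets vs. \<not> (hd vs \<in> A \<and> last vs \<in> A)}"

lemma cycle_sets_iff:
  assumes "3 \<le> length vs"
  shows "A \<in> cycle_sets vs \<longleftrightarrow>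
    A \<subseteq> set vs \<and> (\<forall>i < length vs. \<not> {vs ! i, vs ! (Suc i mod length vs)} \<subseteq> A)"
    (is "_ \<longleftrightarrow> _ \<and> (\<forall>i < ?n. ?P i)")
proof -
  obtain m where m: "?n = Suc m" using assms by (cases ?n) auto
  have "(\<forall>i < ?n. ?P i) \<longleftrightarrow> ?P m \<and> (\<forall>i < m. ?P i)"
    unfolding m by (rule All_less_Suc)
  \<comment> \<open>\<open>m\<close> is the only index at which the modulus wraps around; it gives
    the closing edge.\<close>
  also have "?P m \<longleftrightarrow> \<not> (hd vs \<in> A \<and> last vs \<in> A)"
  proof -
    have "vs \<noteq> []" using assms by auto
    then have "hd vs = vs ! 0" "last vs = vs ! m"
      using m by (simp_all add: hd_conv_nth last_conv_nth)
    then show ?thesis using m by auto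
  qed
  also have "(\<forall>i < m. ?P i) \<longleftrightarrow> (\<forall>i. Suc i < ?n \<longrightarrow> \<not> {vs ! i, vs ! Suc i} \<subseteq> A)"
    by (simp add: m)
  finally show ?thesis by (auto simp: cycle_sets_def path_sets_iff)
qed

text \<open>The cycle \<open>a # b # q\<close> likewise yields \<open>b # q\<close> with residue \<open>q\<close>. A triangle has the residue
  \<open>cycle_sets [c]\<close>, in which only the empty set is independent.\<close>

lemma reducible_cycle_sets:
  assumes "2 \<le> length vs" "distinct vs"
  shows "reducible (cycle_sets vs)"
  using assms
proof (induction "length vs" arbitrary: vs rule: less_induct)
  case less
  obtain a b q where vs: "vs = a # b # q"
    using less.prems(1) by (metis One_nat_def Suc_1 Suc_le_length_iff)
  then have ne: "a \<noteq> b" "a \<notin> set q" "b \<notin> set q" "distinct q" using less.prems(2) by auto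
  show ?case
  proof (cases "q = []")
    case True
    \<comment> \<open>With two vertices the closing edge coincides with the edge of the
      path.\<close>
    then have "cycle_sets vs = path_sets vs" by (auto simp: vs cycle_sets_def path_sets_def)
    then show ?thesis using reducible_path_sets[of vs] less.prems by (simp add: vs)
  next
    case False
    then have hdl: "hd q \<in> set q" "last q \<in> set q" by auto
    then have ne': "hd q \<noteq> a" "hd q \<noteq> b" "last q \<noteq> a" "last q \<noteq> b" using ne by auto
    have in_a: "insert a S \<in> cycle_sets vs \<longleftrightarrow> S \<in> path_sets q \<and> last q \<notin> S"
      and in_b: "insert b S \<in> cycle_sets vs \<longleftrightarrow> S \<in> path_sets q \<and> hd q \<notin> S"
      and in_none: "S \<in> cycle_sets vs \<longleftrightarrow> S \<in> path_sets q"
      if "a \<notin> S" "b \<notin> S" for S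
      using that ne ne' False
      by (auto simp: cycle_sets_def vs path_sets_Cons_insert path_sets_Cons_notin)
    \<comment> \<open>Besides each other, \<open>a\<close> is adjacent to \<open>last q\<close> and
      \<open>b\<close> to \<open>hd q\<close>. So \<open>hd q\<close> obstructs trading
      \<open>a\<close> for \<open>b\<close>, and \<open>last q\<close> obstructs the
      reverse.\<close>
    have con: "contractible a b (cycle_sets vs)"
      unfolding contractible_def
    proof (intro conjI exI allI impI ballI)
      show "\<not> (a \<in> A \<and> b \<in> A)" if "A \<in> cycle_sets vs" for A
        using that by (auto simp: vs cycle_sets_def path_sets_def)
    qed (use ne in \<open>auto simp: in_a in_b\<close>)
    have merged: "merged a b (cycle_sets vs) (cycle_sets vs) = cycle_sets (b # q)"
    proof (rule set_eqI)
      fix A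
      consider "a \<in> A" | "a \<notin> A" "b \<notin> A" | S where "A = insert b S" "a \<notin> S" "b \<notin> S"
        by (metis insertCI mk_disjoint_insert)
      then show "A \<in> merged a b (cycle_sets vs) (cycle_sets vs) \<longleftrightarrow> A \<in> cycle_sets (b # q)"
      proof cases
        case 1
        then show ?thesis using ne by (auto simp: merged_def cycle_sets_def path_sets_def)
      next
        case 2
        then show ?thesis
          by (simp add: merged_def in_none) (simp add: cycle_sets_def path_sets_Cons_notin)
      next
        case 3
        then show ?thesis using ne ne' False
          by (simp add: merged_def in_a in_b) (auto simp add: cycle_sets_def path_sets_Cons_insert)
      qed
    qed
    \<comment> \<open>A set from \<open>path_sets q\<close> extends by neither \<open>a\<close> nor
      \<open>b\<close> exactly when it contains both \<open>hd q\<close> and \<open>last q\<close>,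
      which is what the closing edge of the cycle on \<open>q\<close> forbids.\<close>
    have residue: "residue a b (cycle_sets vs) (cycle_sets vs) = cycle_sets q"
    proof (rule set_eqI)
      fix S
      show "S \<in> residue a b (cycle_sets vs) (cycle_sets vs) \<longleftrightarrow> S \<in> cycle_sets q"
      proof (cases "a \<notin> S \<and> b \<notin> S")
        case True
        then show ?thesis by (simp add: residue_def in_a in_b) (auto simp: cycle_sets_def)
      next
        case False
        then have "S \<notin> cycle_sets q" using ne by (auto simp: cycle_sets_def path_sets_def)
        then show ?thesis using False by (auto simp: residue_def)
      qed
    qed
    have "cycle_sets q = {{}} \<or> reducible (cycle_sets q)"
    proof (cases "2 \<le> length q")
      case True
      then show ?thesis using less.hyps[of q] ne by (simp add: vs)
    next
      case small: False
      then obtain c where "q = [c]" using False by (cases q) (auto simp: Suc_le_eq)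
      then show ?thesis by (auto simp: cycle_sets_def path_sets_def)
    qed
    moreover have "a \<in> \<Union>(cycle_sets vs)" "b \<in> \<Union>(cycle_sets vs)"
      using in_a[of "{}"] in_b[of "{}"] empty_in_path_sets[of q] by auto
    moreover have "reducible (cycle_sets (b # q))"
      using ne False by (auto simp: vs Suc_le_eq intro!: less.hyps)
    ultimately show ?thesis
      using con merged residue by (metis reducible.contract)
  qed
qed

section \<open>From the three graph classes to reducible set systems\<close>

lemma reducible_independent_sets:
  assumes "is_complete H \<or> is_cycle H \<or> is_path H"
  shows "reducible {A. independent_set H A}"
  using assms
proof (elim disjE)
  assume H: "is_complete H"
  then have fin: "finite (verts H)" and E: "edges H = nsets (verts H) 2"
    by (auto simp: is_complete_def)
  have "independent_set H A \<longleftrightarrow> A = {} \<or> (\<exists>v\<in>verts H. A = {v})" for A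
  proof
    assume A: "independent_set H A"
    have "x = y" if "x \<in> A" "y \<in> A" for x y
    proof (rule ccontr)
      assume "x \<noteq> y"
      then have "{x, y} \<in> edges H"
        using that A by (auto simp: independent_set_def E nsets_def)
      then show False using that A by (auto simp: independent_set_def)
    qed
    then have "A = {v}" if "v \<in> A" for v using that by blast
    then show "A = {} \<or> (\<exists>v\<in>verts H. A = {v})"
      using A unfolding independent_set_def by blast
  next
    assume "A = {} \<or> (\<exists>v\<in>verts H. A = {v})"
    then show "independent_set H A"
      by (auto simp: independent_set_def E nsets_def subset_singleton_iff)
  qed
  then have "{A. independent_set H A} = insert {} ((\<lambda>v. {v}) ` verts H)" by auto
  then show ?thesis using reducible_singletons[of "verts H"] H by (simp add: is_complete_def)
next
  assume "is_cycle H"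
  then obtain vs where vs: "3 \<le> length vs" "distinct vs" "verts H = set vs"
    "edges H = {{vs ! i, vs ! (Suc i mod length vs)} | i. i < length vs}"
    by (auto simp: is_cycle_def)
  have "(\<forall>e\<in>edges H. \<not> e \<subseteq> A) \<longleftrightarrow> (\<forall>i. i < length vs \<longrightarrow> \<not> {vs ! i, vs ! (Suc i mod length vs)} \<subseteq> A)" for A
    unfolding vs(4) by blast
  then have "{A. independent_set H A} = cycle_sets vs"
    using vs(1) by (intro set_eqI) (simp add: independent_set_def vs(3) cycle_sets_iff)
  then show ?thesis using reducible_cycle_sets[of vs] vs by simp
next
  assume "is_path H"
  then obtain vs where vs: "vs \<noteq> []" "distinct vs" "verts H = set vs"
    "edges H = {{vs ! i, vs ! Suc i} | i. Suc i < length vs}"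
    by (auto simp: is_path_def)
  have "(\<forall>e\<in>edges H. \<not> e \<subseteq> A) \<longleftrightarrow> (\<forall>i. Suc i < length vs \<longrightarrow> \<not> {vs ! i, vs ! Suc i} \<subseteq> A)" for A
    unfolding vs(4) by blast
  then have "{A. independent_set H A} = path_sets vs"
    using vs(1) by (intro set_eqI) (simp add: independent_set_def vs(3) path_sets_iff)
  then show ?thesis using reducible_path_sets[of vs] vs by simp
qed

section \<open>Assembling the components of the graph\<close>

theorem theorem6:
  fixes r n :: nat and G :: "'a graph" and H :: "nat \<Rightarrow> 'a graph"
  assumes "r \<ge> 1" and "n \<ge> 2 * r"
    and "simple_graph G"
    and "is_disjoint_union G {1..n} H"
    and "\<And>i. i \<in> {1..n} \<Longrightarrow> is_complete (H i) \<or> is_cycle (H i) \<or> is_path (H i)"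
    and "\<exists>i\<in>{1..n}. is_singleton_graph (H i)"
  shows "EKR r G"
proof -
  obtain k x where k: "k \<in> {1..n}" "verts (H k) = {x}" "edges (H k) = {}"
    using assms(6) by (auto simp: is_singleton_graph_def)
  \<comment> \<open>Only the chosen singleton \<open>x\<close> starts as an isolated vertex in
    \<open>Y\<close>; any further singletons stay in \<open>I\<close> as one-vertex
    components.\<close>
  define I where "I = {1..n} - {k}"
  have In: "{1..n} = insert k I" using k by (auto simp: I_def)
  have finG: "finite (verts G)" using assms(3) by (simp add: simple_graph_def)
  have disj: "disjoint_family_on (\<lambda>i. verts (H i)) (insert k I)"
    and V: "verts G = {x} \<union> (\<Union>i\<in>I. verts (H i))" and E: "edges G = (\<Union>i\<in>I. edges (H i))"
    using assms(4) k(2,3) unfolding is_disjoint_union_def In by simp_all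
  \<comment> \<open>Each edge lies within its own component, so independence in \<open>G\<close> can
    be tested component by component.\<close>
  have sub: "e \<subseteq> verts (H i)" if "i \<in> I" "e \<in> edges (H i)" for i e
  proof -
    have "simple_graph (H i)"
      using assms(5)[of i] that is_complete_imp_simple_graph is_cycle_imp_simple_graph
        is_path_imp_simple_graph by (auto simp: I_def)
    then show ?thesis using that by (auto simp: simple_graph_def nsets_def)
  qed
  let ?J = "{A. A \<subseteq> {x} \<union> \<Union>((\<lambda>i. verts (H i)) ` I) \<and>
    (\<forall>i\<in>I. A \<inter> verts (H i) \<in> {A. independent_set (H i) A})}"
  have "star_bounded x (card {x} + card I) ?J"
  proof (rule star_bounded_components)
    show "disjoint_family_on (\<lambda>i. verts (H i)) I"
      using disj by (rule disjoint_family_on_mono[rotated]) auto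
    fix i assume i: "i \<in> I"
    have "verts (H k) \<inter> verts (H i) = {}"
      using disj i by (intro disjoint_family_onD) (auto simp: I_def)
    moreover have "finite (verts (H i))" using finG i V by (auto intro: finite_subset)
    ultimately show "reducible {A. independent_set (H i) A} \<and>
        {A. independent_set (H i) A} \<subseteq> Pow (verts (H i)) \<and> finite (verts (H i)) \<and>
        {x} \<inter> verts (H i) = {}"
      using assms(5)[of i] i k reducible_independent_sets[of "H i"]
      by (auto simp: I_def independent_set_def)
  qed (simp_all add: I_def)
  moreover have "?J = {A. independent_set G A}"
    using sub by (auto simp: independent_set_def V E)
  moreover have "card {x} + card I = n" using k(1) by (simp add: I_def)
  ultimately have star: "star_bounded x n {A. independent_set G A}" by simp
  have lay: "layer r {A. independent_set G A} = indep_family r G"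
    by (auto simp: layer_def indep_family_def independent_set_def)
  show ?thesis
    unfolding EKR_def
  proof (intro allI impI)
    fix F assume "F \<subseteq> indep_family r G" "intersecting F"
    \<comment> \<open>The bound obtained is the star at the isolated vertex \<open>x\<close>, which
      the maximum over all stars dominates.\<close>
    then have "card F \<le> card (star r G x)"
      using star_boundedD[OF star assms(2)] by (simp add: lay star_def)
    also have "\<dots> \<le> Max ((\<lambda>v. card (star r G v)) ` verts G)"
      using finG V by (intro Max_ge) auto
    finally show "card F \<le> Max ((\<lambda>v. card (star r G v)) ` verts G)" .
  qed
qed

end
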